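(* For every BPPS instance, the value $$\hat k=\sum_{c\in\mathcal C}\overline\beta_c$$ is an upper bound on the number of bins used in any optimal BPPS solution, where, for each class $c\in\mathcal C$, $\overline\beta_c$ denotes an (arbitrary) upper bound on the minimum number of bins of capacity $d-s_c$ required to pack all items of $\mathcal I_c$.
   Context: Bin Packing Problem with Setups (BPPS). An instance consists of: a bin capacity $d\in\mathbb Z_{\ge1}$; items $\mathcal I=\{1,\dots,n\}$ with weights $w_i\in\mathbb Z_{\ge1}$; classes $\mathcal C=\{1,\dots,m\}$ and a partition $\{\mathcal I_1,\dots,\mathcal I_m\}$ of $\mathcal I$ into (nonempty) classes; for each class $c$ a setup weight $s_c\in\mathbb Z_{\ge0}$ and a setup cost $f_c\in\mathbb Z_{\ge0}$; a bin cost $r\in\mathbb Z_{\ge1}$. It is assumed that $w_i+s_c\le d$ for all $c\in\mathcal C$, $i\in\mathcal I_c$, and that the items cannot all be packed in a single bin, i.e. $\sum_{i\in\mathcal I}w_i+\sum_{c\in\mathcal C}s_c>d$. For $S\subseteq\mathcal I$ let $\mathcal C(S)=\{c\in\mathcal C: S\cap\mathcal I_c\neq\emptyset\}$. A packing pattern is a subset $S\subseteq\mathcal I$ with $\sum_{i\in S}w_i+\sum_{c\in\mathcal C(S)}s_c\le d$. A feasible solution is a partition $\mathcal S$ of $\mathcal I$ into (nonempty) packing patterns; the number of bins it uses is $|\mathcal S|$ and its cost is $r|\mathcal S|+\sum_{S\in\mathcal S}\sum_{c\in\mathcal C(S)}f_c$. An optimal BPPS solution is a feasible solution of minimum cost.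 The minimum number of bins of capacity $d-s_c$ required to pack all items of $\mathcal I_c$ is the classical bin packing optimum: the minimum number of parts in a partition of $\mathcal I_c$ into subsets each of total weight at most $d-s_c$. *)

theory Defs
  imports Complex_Main "HOL-Library.Disjoint_Sets"
begin

record bpps =
  capacity :: int
  num_items :: nat
  num_classes :: nat
  weight :: "nat \<Rightarrow> int"
  class_items :: "nat \<Rightarrow> nat set"
  setup_weight :: "nat \<Rightarrow> int"
  setup_cost :: "nat \<Rightarrow> int"
  bin_cost :: int

definition items :: "bpps \<Rightarrow> nat set" where
  "items P = {1..num_items P}"

definition classes :: "bpps \<Rightarrow> nat set" where
  "classes P = {1..num_classes P}"

definition bpps_instance :: "bpps \<Rightarrow> bool" where
  "bpps_instance P \<longleftrightarrow>
     capacity P \<ge> 1 \<and>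
     (\<forall>i\<in>items P. weight P i \<ge> 1) \<and>
     disjoint_family_on (class_items P) (classes P) \<and>
     (\<forall>c\<in>classes P. class_items P c \<noteq> {}) \<and>
     (\<Union>c\<in>classes P. class_items P c) = items P \<and>
     (\<forall>c\<in>classes P. setup_weight P c \<ge> 0) \<and>
     (\<forall>c\<in>classes P. setup_cost P c \<ge> 0) \<and>
     bin_cost P \<ge> 1 \<and>
     (\<forall>c\<in>classes P. \<forall>i\<in>class_items P c. weight P i + setup_weight P c \<le> capacity P) \<and>
     (\<Sum>i\<in>items P. weight P i) + (\<Sum>c\<in>classes P. setup_weight P c) > capacity P"

definition classes_of :: "bpps \<Rightarrow> nat set \<Rightarrow> nat set" where
  "classes_of P S = {c \<in> classes P. S \<inter> class_items P c \<noteq> {}}"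

definition packing_pattern :: "bpps \<Rightarrow> nat set \<Rightarrow> bool" where
  "packing_pattern P S \<longleftrightarrow> S \<subseteq> items P \<and>
     (\<Sum>i\<in>S. weight P i) + (\<Sum>c\<in>classes_of P S. setup_weight P c) \<le> capacity P"

(* partition_on requires the parts to be nonempty. *)
definition feasible_solution :: "bpps \<Rightarrow> nat set set \<Rightarrow> bool" where
  "feasible_solution P \<S> \<longleftrightarrow> partition_on (items P) \<S> \<and> (\<forall>S\<in>\<S>. packing_pattern P S)"

definition solution_cost :: "bpps \<Rightarrow> nat set set \<Rightarrow> int" where
  "solution_cost P \<S> =
     bin_cost P * int (card \<S>) + (\<Sum>S\<in>\<S>. \<Sum>c\<in>classes_of P S. setup_cost P c)"

definition optimal_solution :: "bpps \<Rightarrow> nat set set \<Rightarrow> bool" where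
  "optimal_solution P \<S> \<longleftrightarrow> is_arg_min (solution_cost P) (feasible_solution P) \<S>"

definition bin_packing :: "('a \<Rightarrow> int) \<Rightarrow> int \<Rightarrow> 'a set \<Rightarrow> 'a set set \<Rightarrow> bool" where
  "bin_packing w b A \<B> \<longleftrightarrow> partition_on A \<B> \<and> (\<forall>B\<in>\<B>. (\<Sum>i\<in>B. w i) \<le> b)"

(* Meaningful only if A is finite and some packing exists, i.e. every item of A fits into a bin;
   see class_bin_packing_exists below. *)
definition min_bins :: "('a \<Rightarrow> int) \<Rightarrow> int \<Rightarrow> 'a set \<Rightarrow> nat" where
  "min_bins w b A = (LEAST k. \<exists>\<B>. bin_packing w b A \<B> \<and> card \<B> = k)"

lemma class_bin_packing_exists:
  assumes "bpps_instance P" and "c \<in> classes P"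
  shows "\<exists>\<B>. bin_packing (weight P) (capacity P - setup_weight P c) (class_items P c) \<B>"
proof
  show "bin_packing (weight P) (capacity P - setup_weight P c) (class_items P c)
          ((\<lambda>i. {i}) ` class_items P c)"
    unfolding bin_packing_def
  proof
    show "partition_on (class_items P c) ((\<lambda>i. {i}) ` class_items P c)"
      by (auto simp: partition_on_def disjoint_def)
    show "\<forall>B\<in>(\<lambda>i. {i}) ` class_items P c.
            (\<Sum>i\<in>B. weight P i) \<le> capacity P - setup_weight P c"
      using assms unfolding bpps_instance_def by fastforce
  qed
qed

end

theory Submission
  imports Defs
begin

text \<open>Packing every class separately into its minimum number of bins gives a feasible solution
  in which no class is set up more often than in any other feasible solution: the bins of a
  feasible solution that contain items of a class, restricted to that class, already form a bin
  packing of the class with capacity reduced by the setup weight. A solution with more bins than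
  the class-wise one therefore costs strictly more.\<close>

lemma min_bins_le_card:
  assumes "bin_packing w b A \<B>"
  shows "min_bins w b A \<le> card \<B>"
  unfolding min_bins_def using assms by (blast intro: Least_le)

text \<open>One existing packing makes the \<open>LEAST\<close> in \<open>min_bins\<close> a genuine
  minimum; otherwise its value would be unspecified.\<close>

lemma min_bins_attained:
  assumes "bin_packing w b A \<B>"
  obtains \<B>' where "bin_packing w b A \<B>'" and "card \<B>' = min_bins w b A"
proof -
  have "\<exists>\<B>'. bin_packing w b A \<B>' \<and> card \<B>' = min_bins w b A"
    unfolding min_bins_def by (rule LeastI_ex) (use assms in blast)
  then show thesis using that by blast
qed

lemma finite_items [simp]: "finite (items P)"
  by (simp add: items_def)

lemma finite_classes [simp]: "finite (classes P)"
  by (simp add: classes_def)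

lemma finite_classes_of [simp]: "finite (classes_of P S)"
  by (simp add: classes_of_def)

lemma class_items_subset_items:
  assumes "bpps_instance P" and "c \<in> classes P"
  shows "class_items P c \<subseteq> items P"
  using assms unfolding bpps_instance_def by blast

text \<open>Classes are pairwise disjoint, so a nonempty bin filled from one class meets no other
  class and pays a single setup.\<close>

lemma classes_of_subset_class:
  assumes "bpps_instance P" and "c \<in> classes P" and "S \<subseteq> class_items P c" and "S \<noteq> {}"
  shows "classes_of P S = {c}"
proof -
  have "disjoint_family_on (class_items P) (classes P)"
    using assms(1) by (simp add: bpps_instance_def)
  then have "c' = c" if "c' \<in> classes P" "S \<inter> class_items P c' \<noteq> {}" for c'
    using that assms(2,3) unfolding disjoint_family_on_def by blast
  then show ?thesis using assms(2-4) unfolding classes_of_def by blast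
qed

lemma finite_feasible_solution:
  assumes "feasible_solution P \<S>"
  shows "finite \<S>"
  using assms by (auto simp: feasible_solution_def intro: finite_elements[OF finite_items])

text \<open>The capacity constraint of \<open>S\<close> also counts items and setups of other
  classes. All of these are nonnegative, so dropping them leaves the items of \<open>c\<close> and
  one setup of \<open>c\<close>.\<close>

lemma packing_pattern_class_weight:
  assumes inst: "bpps_instance P" and pat: "packing_pattern P S" and c: "c \<in> classes_of P S"
  shows "(\<Sum>i\<in>S \<inter> class_items P c. weight P i) \<le> capacity P - setup_weight P c"
proof -
  have S: "S \<subseteq> items P" using pat by (simp add: packing_pattern_def)
  have "(\<Sum>i\<in>S \<inter> class_items P c. weight P i) \<le> (\<Sum>i\<in>S. weight P i)"
  proof (rule sum_mono2)
    show "finite S" using S finite_items by (rule finite_subset)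
    fix i assume "i \<in> S - S \<inter> class_items P c"
    then have "weight P i \<ge> 1" using inst S unfolding bpps_instance_def by blast
    then show "0 \<le> weight P i" by simp
  qed simp
  moreover have "setup_weight P c \<le> (\<Sum>c\<in>classes_of P S. setup_weight P c)"
    using inst c by (intro member_le_sum) (auto simp: bpps_instance_def classes_of_def)
  ultimately show ?thesis using pat by (simp add: packing_pattern_def)
qed

text \<open>This bounds from below how often any feasible solution has to pay the setup cost of
  class \<open>c\<close>.\<close>

lemma min_bins_le_setups:
  assumes inst: "bpps_instance P" and feas: "feasible_solution P \<S>" and c: "c \<in> classes P"
  shows "min_bins (weight P) (capacity P - setup_weight P c) (class_items P c)
    \<le> card {S \<in> \<S>. c \<in> classes_of P S}"
proof -
  \<comment> \<open>Keeping exactly the bins that meet class \<open>c\<close> makes every restricted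
    bin nonempty, as \<open>partition_on\<close> demands, and loses no item of the class.\<close>
  let ?\<T> = "{S \<in> \<S>. c \<in> classes_of P S}"
  let ?\<B> = "(\<lambda>S. S \<inter> class_items P c) ` ?\<T>"
  have part: "partition_on (items P) \<S>" and pat: "\<And>S. S \<in> \<S> \<Longrightarrow> packing_pattern P S"
    using feas by (auto simp: feasible_solution_def)
  have "partition_on (class_items P c) ?\<B>"
  proof (rule partition_onI)
    have "class_items P c \<subseteq> \<Union>\<S>"
      using part class_items_subset_items[OF inst c] by (simp add: partition_on_def)
    then show "\<Union>?\<B> = class_items P c"
      using c unfolding classes_of_def by blast
  next
    fix X Y assume "X \<in> ?\<B>" "Y \<in> ?\<B>" "X \<noteq> Y"
    then show "disjnt X Y"
      using part unfolding partition_on_def disjoint_def disjnt_def by blast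
  next
    show "{} \<notin> ?\<B>" by (auto simp: classes_of_def)
  qed
  then have "bin_packing (weight P) (capacity P - setup_weight P c) (class_items P c) ?\<B>"
    using packing_pattern_class_weight[OF inst pat] by (auto simp: bin_packing_def)
  then have "min_bins (weight P) (capacity P - setup_weight P c) (class_items P c) \<le> card ?\<B>"
    by (rule min_bins_le_card)
  also have "\<dots> \<le> card ?\<T>"
    using finite_feasible_solution[OF feas] by (intro card_image_le) simp
  finally show ?thesis .
qed

text \<open>Double counting of the pairs of a bin and a class set up in it. In this form two
  solutions can be compared class by class.\<close>

lemma solution_cost_by_class:
  assumes "finite \<S>"
  shows "solution_cost P \<S> = bin_cost P * int (card \<S>)
    + (\<Sum>c\<in>classes P. int (card {S \<in> \<S>. c \<in> classes_of P S}) * setup_cost P c)"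
proof -
  \<comment> \<open>The inner range is written as a restriction of the fixed set
    \<open>classes P\<close>, the shape that \<open>sum.swap_restrict\<close> exchanges.\<close>
  have "(\<Sum>S\<in>\<S>. \<Sum>c\<in>classes_of P S. setup_cost P c)
      = (\<Sum>S\<in>\<S>. \<Sum>c | c \<in> classes P \<and> c \<in> classes_of P S. setup_cost P c)"
    by (intro sum.cong refl) (auto simp: classes_of_def)
  also have "\<dots> = (\<Sum>c\<in>classes P. \<Sum>S | S \<in> \<S> \<and> c \<in> classes_of P S. setup_cost P c)"
    by (rule sum.swap_restrict) (use assms in simp_all)
  finally show ?thesis by (simp add: solution_cost_def)
qed

text \<open>A bin of \<open>\<B> c\<close> holds items of class \<open>c\<close> only, and the
  reduced capacity reserves room for its one setup. The second claim gives the number of setups of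
  \<open>c\<close> in the union as \<open>card (\<B> c)\<close>.\<close>

lemma class_packings_feasible:
  assumes inst: "bpps_instance P"
    and pack: "\<And>c. c \<in> classes P \<Longrightarrow>
      bin_packing (weight P) (capacity P - setup_weight P c) (class_items P c) (\<B> c)"
  shows "feasible_solution P (\<Union>c\<in>classes P. \<B> c)"
    and "\<And>c. c \<in> classes P \<Longrightarrow> {S \<in> (\<Union>c\<in>classes P. \<B> c). c \<in> classes_of P S} = \<B> c"
proof -
  have part: "partition_on (class_items P c) (\<B> c)" if "c \<in> classes P" for c
    using pack[OF that] by (simp add: bin_packing_def)
  have sub: "S \<subseteq> class_items P c" and cls: "classes_of P S = {c}"
    if "c \<in> classes P" "S \<in> \<B> c" for c S
  proof -
    show "S \<subseteq> class_items P c"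
      using part[OF that(1)] that(2) by (auto simp: partition_on_def)
    moreover have "S \<noteq> {}" using part[OF that(1)] that(2) by (auto simp: partition_on_def)
    ultimately show "classes_of P S = {c}"
      using classes_of_subset_class[OF inst that(1)] by blast
  qed
  have "partition_on (items P) (\<Union>c\<in>classes P. \<B> c)"
  proof (rule partition_onI)
    have "\<Union>(\<Union>c\<in>classes P. \<B> c) = (\<Union>c\<in>classes P. \<Union>(\<B> c))" by blast
    also have "\<dots> = (\<Union>c\<in>classes P. class_items P c)"
      by (intro SUP_cong refl) (use part in \<open>simp add: partition_on_def\<close>)
    also have "\<dots> = items P" using inst by (simp add: bpps_instance_def)
    finally show "\<Union>(\<Union>c\<in>classes P. \<B> c) = items P" .
  next
    fix X Y assume "X \<in> (\<Union>c\<in>classes P. \<B> c)" "Y \<in> (\<Union>c\<in>classes P. \<B> c)" and neq: "X \<noteq> Y"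
    then obtain c c' where X: "c \<in> classes P" "X \<in> \<B> c" and Y: "c' \<in> classes P" "Y \<in> \<B> c'"
      by blast
    show "disjnt X Y"
    proof (cases "c = c'")
      case True
      then show ?thesis
        using part[OF X(1)] X Y neq by (auto simp: partition_on_def disjoint_def disjnt_def)
    next
      case False
      then have "class_items P c \<inter> class_items P c' = {}"
        using inst X(1) Y(1) by (auto simp: bpps_instance_def disjoint_family_on_def)
      then show ?thesis using sub[OF X] sub[OF Y] by (auto simp: disjnt_def)
    qed
  next
    show "{} \<notin> (\<Union>c\<in>classes P. \<B> c)" using part by (auto simp: partition_on_def)
  qed
  moreover have "packing_pattern P S" if "c \<in> classes P" "S \<in> \<B> c" for c S
  proof -
    have "S \<subseteq> items P"
      using sub[OF that] class_items_subset_items[OF inst that(1)] by blast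
    moreover have "(\<Sum>i\<in>S. weight P i) \<le> capacity P - setup_weight P c"
      using pack[OF that(1)] that(2) by (simp add: bin_packing_def)
    ultimately show ?thesis by (simp add: packing_pattern_def cls[OF that])
  qed
  ultimately show "feasible_solution P (\<Union>c\<in>classes P. \<B> c)"
    by (auto simp: feasible_solution_def)
  show "{S \<in> (\<Union>c\<in>classes P. \<B> c). c \<in> classes_of P S} = \<B> c" if "c \<in> classes P" for c
    using cls that by (auto dest: cls)
qed

lemma card_optimal_solution_le:
  assumes inst: "bpps_instance P" and opt: "optimal_solution P \<S>"
  shows "card \<S> \<le>
    (\<Sum>c\<in>classes P. min_bins (weight P) (capacity P - setup_weight P c) (class_items P c))"
    (is "_ \<le> (\<Sum>c\<in>_. ?k c)")
proof -
  have feas: "feasible_solution P \<S>"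
    and least: "\<And>\<T>. feasible_solution P \<T> \<Longrightarrow> solution_cost P \<S> \<le> solution_cost P \<T>"
    using opt by (auto simp: optimal_solution_def is_arg_min_linorder)
  have "\<exists>\<B>. bin_packing (weight P) (capacity P - setup_weight P c) (class_items P c) \<B>
      \<and> card \<B> = ?k c" if "c \<in> classes P" for c
    using class_bin_packing_exists[OF inst that] min_bins_attained by metis
  then obtain \<B> where pack: "\<And>c. c \<in> classes P \<Longrightarrow>
        bin_packing (weight P) (capacity P - setup_weight P c) (class_items P c) (\<B> c)"
      and card: "\<And>c. c \<in> classes P \<Longrightarrow> card (\<B> c) = ?k c"
    by metis
  \<comment> \<open>The competitor of the optimal \<open>\<S>\<close>: a minimum packing of each
    class, all put together.\<close>
  define \<T> where "\<T> = (\<Union>c\<in>classes P. \<B> c)"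
  have \<T>: "feasible_solution P \<T>"
    and setups: "\<And>c. c \<in> classes P \<Longrightarrow> {S \<in> \<T>. c \<in> classes_of P S} = \<B> c"
    unfolding \<T>_def using class_packings_feasible[OF inst pack] by auto
  \<comment> \<open>In each class \<open>\<T>\<close> attains the lower bound on setups that
    \<open>\<S>\<close> also obeys, and setup costs are nonnegative.\<close>
  have "(\<Sum>c\<in>classes P. int (card {S \<in> \<T>. c \<in> classes_of P S}) * setup_cost P c)
      \<le> (\<Sum>c\<in>classes P. int (card {S \<in> \<S>. c \<in> classes_of P S}) * setup_cost P c)"
    using inst min_bins_le_setups[OF inst feas]
    by (intro sum_mono mult_right_mono) (simp_all add: setups card bpps_instance_def)
  moreover have "solution_cost P \<S> \<le> solution_cost P \<T>" by (rule least[OF \<T>])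
  \<comment> \<open>\<open>\<S>\<close> costs no more in total but at least as much in setups, so it
    cannot spend more on bins.\<close>
  ultimately have "bin_cost P * int (card \<S>) \<le> bin_cost P * int (card \<T>)"
    by (simp add: solution_cost_by_class finite_feasible_solution[OF feas]
        finite_feasible_solution[OF \<T>])
  \<comment> \<open>Cancels the bin cost, which is at least 1.\<close>
  then have "card \<S> \<le> card \<T>"
    using inst by (simp add: bpps_instance_def)
  also have "\<dots> \<le> (\<Sum>c\<in>classes P. card (\<B> c))"
    unfolding \<T>_def by (rule card_UN_le) simp
  also have "\<dots> = (\<Sum>c\<in>classes P. ?k c)" by (simp add: card)
  finally show ?thesis .
qed

text \<open>Real values of \<open>\<beta>\<close> cover fractional estimates as well as integer
  ones. The bound by the exact class minima carries over by monotonicity of sums.\<close>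

theorem proposition10:
  fixes P :: bpps and \<beta> :: "nat \<Rightarrow> real"
  assumes "bpps_instance P"
    and "\<And>c. c \<in> classes P \<Longrightarrow>
      real (min_bins (weight P) (capacity P - setup_weight P c) (class_items P c)) \<le> \<beta> c"
  shows "\<forall>\<S>. optimal_solution P \<S> \<longrightarrow> real (card \<S>) \<le> (\<Sum>c\<in>classes P. \<beta> c)"
proof (intro allI impI)
  fix \<S> assume "optimal_solution P \<S>"
  then have "real (card \<S>) \<le> real (\<Sum>c\<in>classes P.
      min_bins (weight P) (capacity P - setup_weight P c) (class_items P c))"
    using card_optimal_solution_le[OF assms(1)] of_nat_le_iff by blast
  also have "\<dots> \<le> (\<Sum>c\<in>classes P. \<beta> c)"
    using assms(2) by (simp add: sum_mono)
  finally show "real (card \<S>) \<le> (\<Sum>c\<in>classes P. \<beta> c)" .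
qed

end
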